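(* Let $\mathcal{H}$ be a $d$-dimensional complex Hilbert space, let $\mathcal{A}=\{A_a\}$ be an informationally complete POVM on $\mathcal{H}$, let $n\ge 1$ be the number of measurement results, and let $\overline{\mathcal{E}_{\mathcal{P}}}$ be the mean squared state estimation error of the linear estimator built from the optimal dual frame $|A'_a\rangle=F_s(\mathcal{A})^{-1}|A_a\rangle/\langle A_a|I\rangle$, averaged over all states unitarily equivalent to a given state of purity $\mathcal{P}$. Then $$\frac1n\left(d^2+d-1-\mathcal{P}\right)\ \le\ \overline{\mathcal{E}_{\mathcal{P}}}\ \le\ \frac1n\left(\frac{d^2-1}{d\,s(\mathcal{A})}+\frac1d-\mathcal{P}\right).$$
   Context: $\mathcal{L}(\mathcal{H})$ is the space of linear operators on $\mathcal{H}$ with the Hilbert–Schmidt inner product $\langle A|B\rangle=\mathrm{Tr}[A^\dagger B]$ and norm $\|\cdot\|_2$; $|A\rangle$ denotes $A$ regarded as a vector of this Hilbert space, and $I$ is the identity operator on $\mathcal{H}$. A POVM $\mathcal{A}=\{A_a\}$ on $\mathcal{H}$ is a finite family of nonzero positive semidefinite operators (effects) with $\sum_a A_a=I$; it is informationally complete if its effects span $\mathcal{L}(\mathcal{H})$. The scaled frame operator is $F_s(\mathcal{A})=\sum_a |A_a\rangle\langle A_a|/\langle A_a|I\rangle$, i.e. $F_s(\mathcal{A})(X)=\sum_a\frac{\mathrm{Tr}[A_aX]}{\mathrm{Tr}[A_a]}A_a$; it is invertible when $\mathcal{A}$ is informationally complete. The completeness stability $s(\mathcal{A})$ is the minimum eigenvalue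 of $F_s(\mathcal{A})$. Estimation: a state is a positive semidefinite operator $\rho$ with $\mathrm{Tr}\,\rho=1$, with purity $\mathcal{P}=\mathrm{Tr}[\rho^2]$. Measuring $\mathcal{A}$ independently on $n$ copies of $\rho$ gives outcome counts $(n_a)$ with multinomial distribution with parameters $n$ and $p_a=\mathrm{Tr}[\rho A_a]$; put $f_a=n_a/n$ and $\hat\rho=\sum_a f_aA'_a$, with $A'_a$ the dual frame given in the claim (a dual frame is a family with $\sum_a|A'_a\rangle\langle A_a|$ equal to the identity on $\mathcal{L}(\mathcal{H})$; the one in the claim is called optimal because it minimizes the averaged error below among all dual frames). The mean squared error is $\mathcal{E}_\rho=E\bigl[\|\hat\rho-\rho\|_2^2\bigr]$, and $\overline{\mathcal{E}_{\mathcal{P}}}$ is the average of $\mathcal{E}_{U\rho U^\dagger}$ over Haar-distributed unitaries $U$ on $\mathcal{H}$ (it depends on $\rho$ only through $\mathcal{P}$). *)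

theory Defs
  imports "HOL-Probability.Probability"
begin

text \<open>
  The Hilbert space is modelled as \<open>complex ^ 'n\<close>, with dimension \<open>CARD('n)\<close>, and the space of
  linear operators on it as the type of matrices \<open>complex ^ 'n ^ 'n\<close>.
\<close>

type_synonym 'n op = "complex ^ 'n ^ 'n"

definition cscale :: "complex \<Rightarrow> 'n::finite op \<Rightarrow> 'n op" where
  "cscale c X = (\<chi> i j. c * X $ i $ j)"

text \<open>Only the real structure of this type is available in the library; this provides the complex span.\<close>

global_interpretation cop: vector_space "cscale :: complex \<Rightarrow> 'n::finite op \<Rightarrow> 'n op"
  by unfold_locales (auto simp: cscale_def vec_eq_iff algebra_simps)

definition dagger :: "'n::finite op \<Rightarrow> 'n op" where
  "dagger X = (\<chi> i j. cnj (X $ j $ i))"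

definition hs_inner :: "'n::finite op \<Rightarrow> 'n op \<Rightarrow> complex" where
  "hs_inner X Y = trace (dagger X ** Y)"

definition hs_norm :: "'n::finite op \<Rightarrow> real" where
  "hs_norm X = sqrt (Re (hs_inner X X))"

definition psd :: "'n::finite op \<Rightarrow> bool" where
  "psd X \<longleftrightarrow> dagger X = X \<and> (\<forall>v. 0 \<le> Re (\<Sum>i\<in>UNIV. cnj (v $ i) * (X *v v) $ i))"

definition unitary_group :: "'n::finite op set" where
  "unitary_group = {U. dagger U ** U = mat 1 \<and> U ** dagger U = mat 1}"

definition povm :: "('a::finite \<Rightarrow> 'n::finite op) \<Rightarrow> bool" where
  "povm A \<longleftrightarrow> (\<forall>a. psd (A a) \<and> A a \<noteq> 0) \<and> (\<Sum>a\<in>UNIV. A a) = mat 1"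

definition informationally_complete :: "('a::finite \<Rightarrow> 'n::finite op) \<Rightarrow> bool" where
  "informationally_complete A \<longleftrightarrow> cop.span (range A) = UNIV"

definition scaled_frame_op :: "('a::finite \<Rightarrow> 'n::finite op) \<Rightarrow> 'n op \<Rightarrow> 'n op" where
  "scaled_frame_op A X =
     (\<Sum>a\<in>UNIV. cscale (hs_inner (A a) X / hs_inner (A a) (mat 1)) (A a))"

definition op_eigenvalues :: "('n::finite op \<Rightarrow> 'n op) \<Rightarrow> complex set" where
  "op_eigenvalues F = {z. \<exists>X. X \<noteq> 0 \<and> F X = cscale z X}"

text \<open>
  For a POVM the scaled frame operator is self-adjoint, so all its eigenvalues are real;
  there are at least one and at most \<open>CARD('n)\<^sup>2\<close> of them, so \<^const>\<open>Min\<close> is well-defined.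
\<close>

definition completeness_stability :: "('a::finite \<Rightarrow> 'n::finite op) \<Rightarrow> real" where
  "completeness_stability A = Min {x. complex_of_real x \<in> op_eigenvalues (scaled_frame_op A)}"

definition optimal_dual :: "('a::finite \<Rightarrow> 'n::finite op) \<Rightarrow> 'a \<Rightarrow> 'n op" where
  "optimal_dual A a =
     inv (scaled_frame_op A) (cscale (1 / hs_inner (A a) (mat 1)) (A a))"

definition quantum_state :: "'n::finite op \<Rightarrow> bool" where
  "quantum_state \<rho> \<longleftrightarrow> psd \<rho> \<and> trace \<rho> = 1"

text \<open>The trace in question is real for every hermitian operator.\<close>

definition purity :: "'n::finite op \<Rightarrow> real" where
  "purity \<rho> = Re (trace (\<rho> ** \<rho>))"

text \<open>
  For a state and a POVM the weights \<open>Tr[\<rho> A\<^sub>a]\<close> are real, nonnegative and sum to one;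
  \<^const>\<open>embed_pmf\<close> is only meaningful in that case.
\<close>

definition outcome_pmf :: "('a::finite \<Rightarrow> 'n::finite op) \<Rightarrow> 'n op \<Rightarrow> 'a pmf" where
  "outcome_pmf A \<rho> = embed_pmf (\<lambda>a. Re (trace (\<rho> ** A a)))"

text \<open>The multinomial distribution: occurrence counts of the values in \<open>n\<close> independent draws from \<open>p\<close>.\<close>

definition multinomial_pmf :: "nat \<Rightarrow> 'a pmf \<Rightarrow> ('a \<Rightarrow> nat) pmf" where
  "multinomial_pmf n p = map_pmf count_list (replicate_pmf n p)"

definition linear_estimator ::
    "('a::finite \<Rightarrow> 'n::finite op) \<Rightarrow> nat \<Rightarrow> ('a \<Rightarrow> nat) \<Rightarrow> 'n op" where
  "linear_estimator D n N = (\<Sum>a\<in>UNIV. (real (N a) / real n) *\<^sub>R D a)"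

definition mse ::
    "('a::finite \<Rightarrow> 'n::finite op) \<Rightarrow> ('a \<Rightarrow> 'n op) \<Rightarrow> nat \<Rightarrow> 'n op \<Rightarrow> real" where
  "mse A D n \<rho> = measure_pmf.expectation (multinomial_pmf n (outcome_pmf A \<rho>))
     (\<lambda>N. (hs_norm (linear_estimator D n N - \<rho>))\<^sup>2)"

text \<open>
  The Haar probability measure lives on the unitary group itself (its space is \<^const>\<open>unitary_group\<close>),
  so values of an integrand at non-unitary matrices are irrelevant, also for measurability.
  Since the group is compact, left invariance determines the measure.
\<close>

definition haar_unitary :: "'n::finite op measure \<Rightarrow> bool" where
  "haar_unitary \<mu> \<longleftrightarrow> prob_space \<mu> \<and> sets \<mu> = sets (restrict_space borel unitary_group) \<and>
     (\<forall>V\<in>unitary_group. distr \<mu> \<mu> (\<lambda>U. V ** U) = \<mu>)"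

definition averaged_mse ::
    "'n::finite op measure \<Rightarrow> ('a::finite \<Rightarrow> 'n op) \<Rightarrow> ('a \<Rightarrow> 'n op) \<Rightarrow> nat \<Rightarrow> 'n op \<Rightarrow> real" where
  "averaged_mse \<mu> A D n \<rho> = (LINT U|\<mu>. mse A D n (U ** \<rho> ** dagger U))"

end

theory Submission
  imports Defs
begin

text \<open>
  Write \<open>t\<^sub>a = Tr A\<^sub>a\<close>, \<open>D\<^sub>a = F\<^sup>-\<^sup>1 A\<^sub>a / t\<^sub>a\<close>. The multinomial variance gives
  \<open>n \<E>\<^sub>\<rho> = \<Sum>\<^sub>a Tr[\<rho> A\<^sub>a] \<parallel>D\<^sub>a\<parallel>\<^sup>2 - P\<close>, and the Haar average of \<open>U \<rho> U\<^sup>*\<close> is \<open>I / d\<close>, so the averaged error is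
  \<open>(T / d - P) / n\<close> with \<open>T = \<Sum>\<^sub>a t\<^sub>a \<parallel>D\<^sub>a\<parallel>\<^sup>2 = Tr F\<^sup>-\<^sup>1\<close>. Instead of diagonalizing \<open>F\<close>, the lower
  bound on \<open>T\<close> comes from expanding \<open>0 \<le> \<Sum>\<^sub>a t\<^sub>a \<parallel>D\<^sub>a + I - (d + 1) A\<^sub>a / t\<^sub>a\<parallel>\<^sup>2\<close>, and the upper bound
  from \<open>s \<parallel>B\<^sub>a\<parallel>\<^sup>2 \<le> \<langle>B\<^sub>a, F B\<^sub>a\<rangle>\<close> for the traceless parts \<open>B\<^sub>a = D\<^sub>a - I / d\<close>, whose weighted sum of
  right-hand sides is \<open>d\<^sup>2 - 1\<close>. The real part of the Hilbert--Schmidt inner product is the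
  library's real inner product on matrices, so \<open>F\<close> can be treated as a self-adjoint operator
  on a Euclidean space.
\<close>

subsection \<open>Positive semidefinite matrices\<close>

definition cdot :: "complex ^ 'n::finite \<Rightarrow> complex ^ 'n \<Rightarrow> complex" where
  "cdot u v = (\<Sum>i\<in>UNIV. cnj (u $ i) * v $ i)"

lemma psd_iff_cdot: "psd X \<longleftrightarrow> dagger X = X \<and> (\<forall>v. 0 \<le> Re (cdot v (X *v v)))"
  by (simp add: psd_def cdot_def)

lemma cdot_add_left: "cdot (u + v) w = cdot u w + cdot v w"
  and cdot_add_right: "cdot w (u + v) = cdot w u + cdot w v"
  and cdot_scale_left: "cdot (c *s u) w = cnj c * cdot u w"
  and cdot_scale_right: "cdot w (c *s u) = c * cdot w u"
  by (simp_all add: cdot_def algebra_simps sum.distrib sum_distrib_left)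

lemma cnj_cdot: "cnj (cdot u v) = cdot v u"
  by (simp add: cdot_def mult.commute)

lemma cdot_adjoint: "cdot u (X *v v) = cdot (dagger X *v u) v"
proof -
  have "cdot u (X *v v) = (\<Sum>i\<in>UNIV. \<Sum>j\<in>UNIV. cnj (u $ i) * (X $ i $ j * v $ j))"
    by (simp add: cdot_def matrix_vector_mult_def sum_distrib_left)
  also have "\<dots> = (\<Sum>j\<in>UNIV. \<Sum>i\<in>UNIV. cnj (u $ i) * (X $ i $ j * v $ j))"
    by (rule sum.swap)
  also have "\<dots> = cdot (dagger X *v u) v"
    by (simp add: cdot_def matrix_vector_mult_def dagger_def sum_distrib_left sum_distrib_right mult_ac)
  finally show ?thesis .
qed

lemma dagger_mult: "dagger (X ** Y) = dagger Y ** dagger X"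
  by (simp add: dagger_def matrix_matrix_mult_def vec_eq_iff mult.commute)

lemma dagger_dagger [simp]: "dagger (dagger X) = X"
  by (simp add: dagger_def vec_eq_iff)

lemma cdot_axis_left: "cdot (axis i 1) v = v $ i"
  by (simp add: cdot_def axis_def if_distrib if_distribR cong: if_cong)

lemma matrix_vector_axis: "((X :: complex ^ 'n ^ 'n) *v axis j 1) $ i = X $ i $ j"
  by (simp add: matrix_vector_mult_def axis_def if_distrib if_distribR cong: if_cong)

text \<open>The form of \<open>X\<close> is nonnegative at \<open>m u - s v\<close> for every real
  \<open>s\<close>; a good choice of \<open>s\<close> in the resulting quadratic gives the bound,
  also for degenerate \<open>X\<close>.\<close>

lemma psd_Cauchy_Schwarz:
  assumes "psd X"
  shows "(cmod (cdot u (X *v v)))\<^sup>2 \<le> Re (cdot u (X *v u)) * Re (cdot v (X *v v))"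
proof -
  define m where "m = cdot u (X *v v)"
  define a where "a = Re (cdot u (X *v u))"
  define b where "b = Re (cdot v (X *v v))"
  have herm: "dagger X = X" and pos: "\<And>w. 0 \<le> Re (cdot w (X *v w))"
    using assms by (auto simp: psd_iff_cdot)
  have m': "cdot v (X *v u) = cnj m"
    by (simp add: m_def cnj_cdot cdot_adjoint herm)
  \<comment> \<open>The factor \<open>m\<close> on \<open>u\<close> aligns the phases: both cross
    terms become \<open>- s * (cmod m)\<^sup>2\<close>.\<close>
  have quad: "0 \<le> (cmod m)\<^sup>2 * a - 2 * s * (cmod m)\<^sup>2 + s\<^sup>2 * b" for s :: real
  proof -
    have "0 \<le> Re (cdot (m *s u + (- complex_of_real s) *s v) (X *v (m *s u + (- complex_of_real s) *s v)))"
      by (rule pos)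
    also have "\<dots> = (cmod m)\<^sup>2 * a - 2 * s * (cmod m)\<^sup>2 + s\<^sup>2 * b"
      unfolding matrix_vector_right_distrib cdot_add_left cdot_add_right
        vector_scalar_commute cdot_scale_left cdot_scale_right m' m_def[symmetric]
      by (simp add: a_def b_def cmod_power2) (simp add: power2_eq_square algebra_simps)
    finally show ?thesis .
  qed
  show ?thesis
  proof (cases "b = 0")
    case True
    \<comment> \<open>For \<open>b = 0\<close> this choice of \<open>s\<close> makes the quadratic
      equal to \<open>- 2 * (cmod m)\<^sup>2\<close>, which forces \<open>m = 0\<close>.\<close>
    have "0 \<le> (cmod m)\<^sup>2 * a - 2 * (a / 2 + 1) * (cmod m)\<^sup>2"
      using quad[of "a / 2 + 1"] True by simp
    then have "(cmod m)\<^sup>2 \<le> 0" by (simp add: algebra_simps)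
    then show ?thesis using True by (simp add: m_def b_def)
  next
    case False
    then have b: "b > 0" using pos[of v] by (simp add: b_def)
    \<comment> \<open>Here \<open>s\<close> is the minimizer of the quadratic.\<close>
    have "0 \<le> (cmod m)\<^sup>2 * (a - (cmod m)\<^sup>2 / b)"
      using quad[of "(cmod m)\<^sup>2 / b"] b by (simp add: power2_eq_square field_simps)
    then have "m = 0 \<or> (cmod m)\<^sup>2 / b \<le> a"
      by (auto simp: zero_le_mult_iff)
    moreover have "a * b \<ge> 0" using pos b by (simp add: a_def)
    ultimately have "(cmod m)\<^sup>2 \<le> a * b"
      using b by (auto simp: pos_divide_le_eq)
    then show ?thesis by (simp add: m_def a_def b_def)
  qed
qed

lemma psd_diag_real:
  assumes "psd X" shows "X $ i $ i = of_real (Re (X $ i $ i))" and "0 \<le> Re (X $ i $ i)"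
proof -
  have "dagger X $ i $ i = X $ i $ i" using assms by (simp add: psd_def)
  then show "X $ i $ i = of_real (Re (X $ i $ i))"
    by (simp add: dagger_def complex_eq_iff)
  show "0 \<le> Re (X $ i $ i)"
    using assms[unfolded psd_iff_cdot] by (metis cdot_axis_left matrix_vector_axis)
qed

text \<open>Nonnegativity of the principal 2x2 minors; in particular a zero on the diagonal clears
  its row and column.\<close>

lemma psd_entry_bound:
  assumes "psd X" shows "(cmod (X $ i $ j))\<^sup>2 \<le> Re (X $ i $ i) * Re (X $ j $ j)"
  using psd_Cauchy_Schwarz[OF assms, of "axis i 1" "axis j 1"]
  by (simp add: cdot_axis_left matrix_vector_axis)

lemma trace_mult_outer:
  "trace ((X :: complex ^ 'n ^ 'n) ** (\<chi> i j. w $ i * cnj (w $ j))) = cdot w (X *v w)"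
  by (simp add: trace_def matrix_matrix_mult_def cdot_def matrix_vector_mult_def
      sum_distrib_left sum_distrib_right mult_ac)

text \<open>Induction by Cholesky elimination: subtracting the rank-one operator \<open>w w\<^sup>* / X\<^sub>i\<^sub>i\<close>,
  with \<open>w\<close> the \<open>i\<close>-th column of \<open>X\<close>, keeps \<open>X\<close> positive and clears its \<open>i\<close>-th diagonal entry.\<close>

lemma trace_psd_mult_nonneg:
  assumes "psd R" "psd X" shows "0 \<le> Re (trace (R ** X))"
  using assms(2)
proof (induction "card {i. X $ i $ i \<noteq> 0}" arbitrary: X rule: less_induct)
  case less
  note X = less.prems
  have herm: "dagger X = X" using X by (simp add: psd_def)
  show ?case
  proof (cases "\<exists>i. X $ i $ i \<noteq> 0")
    case False
    then have "cmod (X $ i $ j) = 0" for i j using psd_entry_bound[OF X, of i j] by simp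
    then have "X = 0" by (simp add: vec_eq_iff)
    then show ?thesis by (simp add: trace_def)
  next
    case True
    then obtain i where i: "X $ i $ i \<noteq> 0" by blast
    define b where "b = Re (X $ i $ i)"
    have Xii: "X $ i $ i = of_real b" using psd_diag_real(1)[OF X] by (simp add: b_def)
    have "b \<noteq> 0" using i Xii by auto
    then have b: "b > 0" using psd_diag_real(2)[OF X, of i] by (simp add: b_def[symmetric])
    define w where "w = X *v axis i 1"
    have wk: "w $ k = X $ k $ i" for k by (simp add: w_def matrix_vector_axis)
    define W where "W = (\<chi> k l. w $ k * cnj (w $ l))"
    have bW: "((1 / b) *\<^sub>R W) $ k $ l = of_real (1 / b) * W $ k $ l" for k l
      by (simp only: vector_scaleR_component) (simp only: scaleR_conv_of_real)
    define Y where "Y = X - (1 / b) *\<^sub>R W"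
    have XY: "X = Y + (1 / b) *\<^sub>R W" by (simp add: Y_def)
    have Wv: "cdot v (W *v v) = of_real ((cmod (cdot v w))\<^sup>2)" for v
    proof -
      have "cdot v (W *v v) = cdot v w * cdot w v"
        by (simp add: W_def cdot_def matrix_vector_mult_def sum_product sum_distrib_left mult_ac)
      then show ?thesis by (metis cnj_cdot complex_norm_square)
    qed
    have dW: "dagger W = W" by (simp add: W_def dagger_def vec_eq_iff mult.commute)
    have "dagger Y = dagger X - (1 / b) *\<^sub>R dagger W" by (simp add: Y_def dagger_def vec_eq_iff)
    then have dY: "dagger Y = Y" by (simp add: dW herm Y_def)
    have Yv: "0 \<le> Re (cdot v (Y *v v))" for v
    proof -
      \<comment> \<open>Positivity of \<open>Y\<close> is exactly the Cauchy-Schwarz inequality for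
        \<open>X\<close> between \<open>v\<close> and the \<open>i\<close>-th basis vector.\<close>
      have "(cmod (cdot v w))\<^sup>2 \<le> Re (cdot v (X *v v)) * b"
        using psd_Cauchy_Schwarz[OF X, of v "axis i 1"]
        by (simp add: w_def[symmetric] cdot_axis_left wk b_def[symmetric])
      moreover have "cdot v (Y *v v) = cdot v (X *v v) - of_real (1 / b) * cdot v (W *v v)"
        by (simp add: Y_def cdot_def matrix_vector_mult_def bW sum_subtractf sum_distrib_left
            algebra_simps del: vector_scaleR_component)
      then have "Re (cdot v (Y *v v)) = Re (cdot v (X *v v)) - (cmod (cdot v w))\<^sup>2 / b"
        by (simp add: Wv del: of_real_power)
      ultimately show ?thesis using b by (simp add: pos_divide_le_eq)
    qed
    have Y: "psd Y" using dY Yv by (simp add: psd_iff_cdot)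
    have Ykk: "Y $ k $ k = X $ k $ k - of_real ((cmod (X $ k $ i))\<^sup>2 / b)" for k
      by (simp add: Y_def bW del: vector_scaleR_component)
        (simp add: W_def wk complex_norm_square[symmetric])
    \<comment> \<open>Earlier diagonal zeros persist because the entry bound gives
      \<open>X $ k $ i = 0\<close>; the new zero at \<open>i\<close> makes the induction measure
      drop.\<close>
    have "Y $ i $ i = 0" using b by (simp add: Ykk Xii power2_eq_square)
    moreover have "Y $ k $ k = 0" if "X $ k $ k = 0" for k
      using psd_entry_bound[OF X, of k i] that by (simp add: Ykk)
    ultimately have "{k. Y $ k $ k \<noteq> 0} \<subset> {k. X $ k $ k \<noteq> 0}" using i by auto
    then have "0 \<le> Re (trace (R ** Y))"
      by (intro less.hyps Y psubset_card_mono) auto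
    moreover have "trace (R ** X) = trace (R ** Y) + of_real (1 / b) * trace (R ** W)"
      by (subst XY) (simp add: trace_def matrix_matrix_mult_def bW sum.distrib sum_distrib_left
          algebra_simps del: vector_scaleR_component)
    moreover have "0 \<le> Re (trace (R ** W))"
      using assms(1) by (simp add: W_def trace_mult_outer psd_iff_cdot)
    ultimately show ?thesis using b by simp
  qed
qed

subsection \<open>The Hilbert--Schmidt inner product\<close>

lemma hs_inner_sum: "hs_inner X Y = (\<Sum>i\<in>UNIV. \<Sum>j\<in>UNIV. cnj (X $ i $ j) * Y $ i $ j)"
  unfolding hs_inner_def trace_def matrix_matrix_mult_def dagger_def
  by (simp, rule sum.swap)

lemma Re_hs_inner: "Re (hs_inner X Y) = X \<bullet> Y"
  by (simp add: hs_inner_sum inner_vec_def inner_complex_def)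

lemma hs_norm_eq_norm: "hs_norm X = norm X"
  by (simp add: hs_norm_def Re_hs_inner norm_eq_sqrt_inner)

lemma cnj_hs_inner: "cnj (hs_inner X Y) = hs_inner Y X"
  by (simp add: hs_inner_sum mult.commute)

lemma hs_inner_add_right: "hs_inner X (Y + Z) = hs_inner X Y + hs_inner X Z"
  and hs_inner_cscale_right: "hs_inner X (cscale c Y) = c * hs_inner X Y"
  by (simp_all add: hs_inner_sum cscale_def algebra_simps sum.distrib sum_distrib_left)

lemma cscale_of_real: "cscale (of_real c) X = c *\<^sub>R X"
  by (simp add: cscale_def vec_eq_iff) (simp add: scaleR_conv_of_real)

lemma psd_trace_real:
  assumes "psd X" shows "trace X = of_real (Re (trace X))" "0 \<le> Re (trace X)"
proof -
  show "trace X = of_real (Re (trace X))"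
    unfolding trace_def by (simp add: of_real_sum psd_diag_real(1)[OF assms, symmetric])
  show "0 \<le> Re (trace X)"
    by (simp add: trace_def sum_nonneg psd_diag_real(2)[OF assms])
qed

text \<open>The entry bounds, summed over all index pairs, factor into the squared trace.\<close>

lemma psd_norm_le_trace:
  assumes "psd X" shows "norm X \<le> Re (trace X)"
proof (rule power2_le_imp_le)
  have "(norm X)\<^sup>2 = (\<Sum>i\<in>UNIV. \<Sum>j\<in>UNIV. (cmod (X $ i $ j))\<^sup>2)"
    by (simp add: power2_norm_eq_inner inner_vec_def)
  also have "\<dots> \<le> (\<Sum>i\<in>UNIV. \<Sum>j\<in>UNIV. Re (X $ i $ i) * Re (X $ j $ j))"
    by (intro sum_mono psd_entry_bound assms)
  also have "\<dots> = (Re (trace X))\<^sup>2"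
    by (simp add: trace_def power2_eq_square sum_product)
  finally show "(norm X)\<^sup>2 \<le> (Re (trace X))\<^sup>2" .
qed (rule psd_trace_real(2)[OF assms])

subsection \<open>Extremal eigenvalues of self-adjoint operators\<close>

text \<open>The Rayleigh quotient attains its minimum on the compact unit sphere, and the
  first-order condition there is the eigenvalue equation.\<close>

lemma selfadjoint_min_eigenvector:
  fixes f :: "'v::euclidean_space \<Rightarrow> 'v"
  assumes lin: "linear f" and sym: "\<And>x y. x \<bullet> f y = f x \<bullet> y"
  obtains l x where "x \<noteq> 0" "f x = l *\<^sub>R x" "\<And>y. l * (norm y)\<^sup>2 \<le> y \<bullet> f y"
proof -
  have "continuous_on (sphere 0 1) (\<lambda>x. x \<bullet> f x)"
    using lin by (intro continuous_intros linear_continuous_on) (simp add: linear_linear)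
  moreover have "sphere (0::'v) 1 \<noteq> {}" by simp
  ultimately obtain x where x: "x \<in> sphere 0 1" and min: "\<And>y. y \<in> sphere 0 1 \<Longrightarrow> x \<bullet> f x \<le> y \<bullet> f y"
    using continuous_attains_inf[of "sphere (0::'v) 1"] compact_sphere by blast
  define l where "l = x \<bullet> f x"
  have nx: "norm x = 1" using x by simp
  have Rayleigh: "l * (norm y)\<^sup>2 \<le> y \<bullet> f y" for y
  proof (cases "y = 0")
    case False
    then have "l \<le> (y /\<^sub>R norm y) \<bullet> f (y /\<^sub>R norm y)"
      unfolding l_def by (intro min) simp
    also have "\<dots> = (y \<bullet> f y) / (norm y)\<^sup>2"
      by (simp add: linear_cmul[OF lin] power2_eq_square divide_inverse)
    finally show ?thesis using False by (simp add: field_simps)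
  qed simp
  \<comment> \<open>\<open>g\<close> is nonnegative and vanishes at the minimizer \<open>x\<close>;
    the residual \<open>h\<close> of the eigenvalue equation is half its gradient there.\<close>
  define g where "g y = y \<bullet> f y - l * (y \<bullet> y)" for y
  define h where "h = f x - l *\<^sub>R x"
  have g_nonneg: "0 \<le> g y" for y
    using Rayleigh[of y] by (simp add: g_def power2_norm_eq_inner)
  have gx: "g x = 0" using nx by (simp add: g_def l_def norm_eq_1)
  have expand: "g (x + t *\<^sub>R h) = 2 * t * (h \<bullet> h) + t\<^sup>2 * g h" for t
  proof -
    have "g (x + t *\<^sub>R h) = g x + 2 * t * (h \<bullet> (f x - l *\<^sub>R x)) + t\<^sup>2 * g h"
      using sym[of x h]
      by (simp add: g_def linear_add[OF lin] linear_cmul[OF lin] inner_add_left inner_add_right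
          inner_diff_right power2_eq_square inner_commute algebra_simps)
    then show ?thesis by (simp add: gx h_def[symmetric])
  qed
  have "h \<bullet> h \<le> 0"
  proof (rule ccontr)
    assume "\<not> h \<bullet> h \<le> 0"
    then have pos: "0 < h \<bullet> h" by linarith
    have g1: "0 < g h + 1" using g_nonneg[of h] by simp
    \<comment> \<open>A step so short that the linear term beats the quadratic one; the
      \<open>+ 1\<close> keeps the denominator positive even if \<open>g h = 0\<close>.\<close>
    define e where "e = (h \<bullet> h) / (g h + 1)"
    have e: "0 < e" "e * (g h + 1) = h \<bullet> h" using pos g1 by (simp_all add: e_def)
    have "0 \<le> g (x + (- e) *\<^sub>R h)" by (rule g_nonneg)
    also have "\<dots> = e * (e * g h - 2 * (h \<bullet> h))"
      unfolding expand by (simp add: power2_eq_square algebra_simps)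
    finally have "2 * (h \<bullet> h) \<le> e * g h" using e(1) by (simp add: zero_le_mult_iff)
    also have "e * g h = h \<bullet> h - e" using e(2) by (simp add: algebra_simps)
    finally show False using pos e(1) by simp
  qed
  then have "h = 0" by (metis inner_eq_zero_iff inner_ge_zero order_antisym)
  then have "f x = l *\<^sub>R x" by (simp add: h_def)
  moreover have "x \<noteq> 0" using nx by auto
  ultimately show thesis using Rayleigh that by blast
qed

text \<open>Symmetry makes eigenvectors of distinct eigenvalues orthogonal, and a Euclidean space
  has room for only finitely many. This gives the \<open>Min\<close> in
  \<open>completeness_stability\<close> its meaning.\<close>

lemma selfadjoint_finite_eigenvalues:
  fixes f :: "'v::euclidean_space \<Rightarrow> 'v"
  assumes sym: "\<And>x y. x \<bullet> f y = f x \<bullet> y"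
  shows "finite {l. \<exists>x. x \<noteq> 0 \<and> f x = l *\<^sub>R x}" (is "finite ?E")
proof -
  define v where "v l = (SOME x. x \<noteq> 0 \<and> f x = l *\<^sub>R x)" for l
  have v: "v l \<noteq> 0" "f (v l) = l *\<^sub>R v l" if "l \<in> ?E" for l
  proof -
    have "\<exists>x. x \<noteq> 0 \<and> f x = l *\<^sub>R x" using that by simp
    then have "v l \<noteq> 0 \<and> f (v l) = l *\<^sub>R v l" unfolding v_def by (rule someI_ex)
    then show "v l \<noteq> 0" "f (v l) = l *\<^sub>R v l" by auto
  qed
  have "orthogonal (v k) (v l)" if "k \<in> ?E" "l \<in> ?E" "k \<noteq> l" for k l
  proof -
    have "l * (v k \<bullet> v l) = k * (v k \<bullet> v l)"
      using sym[of "v k" "v l"] v(2)[OF that(1)] v(2)[OF that(2)] by simp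
    then show ?thesis using \<open>k \<noteq> l\<close> by (simp add: orthogonal_def)
  qed
  then have "pairwise orthogonal (v ` ?E)" by (force simp: pairwise_def)
  then have "finite (v ` ?E)" by (rule pairwise_orthogonal_imp_finite)
  moreover have "inj_on v ?E"
  proof (rule inj_onI)
    fix k l assume "k \<in> ?E" "l \<in> ?E" "v k = v l"
    then have "k *\<^sub>R v k = l *\<^sub>R v k" by (metis v(2))
    then show "k = l" using v(1)[OF \<open>k \<in> ?E\<close>] by simp
  qed
  ultimately show ?thesis by (rule finite_imageD)
qed

subsection \<open>The scaled frame operator and its dual frame\<close>

lemma hs_inner_sum_right: "hs_inner X (\<Sum>a\<in>S. f a) = (\<Sum>a\<in>S. hs_inner X (f a))"
proof -
  have "hs_inner X 0 = 0" by (simp add: hs_inner_sum)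
  then show ?thesis by (induction S rule: infinite_finite_induct) (simp_all add: hs_inner_add_right)
qed

lemma hs_inner_mat_1_right: "hs_inner X (mat 1) = trace (dagger X)"
  by (simp add: hs_inner_def)

lemma mat_1_inner:
  fixes X :: "'n::finite op"
  shows "mat 1 \<bullet> X = Re (trace X)"
proof -
  have "dagger (mat 1) = (mat 1 :: 'n::finite op)" by (simp add: dagger_def mat_def vec_eq_iff)
  then have "hs_inner (mat 1) X = trace X" by (simp add: hs_inner_def)
  then show ?thesis by (metis Re_hs_inner)
qed

locale ic_povm =
  fixes A :: "'a::finite \<Rightarrow> 'n::finite op" and d :: real
  assumes dim: "d = real CARD('n)" and povm: "povm A" and complete: "informationally_complete A"
begin

abbreviation t :: "'a \<Rightarrow> real" where "t a \<equiv> Re (trace (A a))"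
abbreviation F :: "'n op \<Rightarrow> 'n op" where "F \<equiv> scaled_frame_op A"
abbreviation D :: "'a \<Rightarrow> 'n op" where "D \<equiv> optimal_dual A"
abbreviation s :: real where "s \<equiv> completeness_stability A"

lemma psd_A: "psd (A a)" and A_nonzero: "A a \<noteq> 0" and sum_A: "(\<Sum>a\<in>UNIV. A a) = mat 1"
  using povm by (simp_all add: povm_def)

text \<open>By the norm bound a positive operator of trace zero vanishes.\<close>

lemma t_pos: "0 < t a"
  using psd_norm_le_trace[OF psd_A[of a]] A_nonzero[of a] by (smt (verit) zero_less_norm_iff)

lemma mat_1_inner_mat_1: "mat 1 \<bullet> (mat 1 :: 'n op) = d"
  by (simp add: mat_1_inner trace_I dim)

lemma sum_t: "(\<Sum>a\<in>UNIV. t a) = d"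
  by (simp add: mat_1_inner[symmetric] inner_sum_right[symmetric] sum_A mat_1_inner_mat_1)

lemma hs_inner_A_mat_1: "hs_inner (A a) (mat 1) = of_real (t a)"
  using psd_trace_real(1)[OF psd_A[of a]] psd_A[of a] by (simp add: hs_inner_mat_1_right psd_def)

lemma frame_op_eq: "F X = (\<Sum>a\<in>UNIV. cscale (hs_inner (A a) X / of_real (t a)) (A a))"
  by (simp add: scaled_frame_op_def hs_inner_A_mat_1)

lemma frame_op_add: "F (X + Y) = F X + F Y"
  by (simp add: frame_op_eq hs_inner_add_right add_divide_distrib cop.scale_left_distrib sum.distrib)

lemma frame_op_cscale: "F (cscale c X) = cscale c (F X)"
  by (simp add: frame_op_eq hs_inner_cscale_right cop.scale_sum_right)

lemma linear_frame_op: "linear F"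
  by (intro linearI) (simp_all add: frame_op_add frame_op_cscale cscale_of_real[symmetric])

lemma hs_inner_frame_op:
  "hs_inner Y (F X) = (\<Sum>a\<in>UNIV. cnj (hs_inner (A a) Y) * hs_inner (A a) X / of_real (t a))"
  by (simp add: frame_op_eq hs_inner_sum_right hs_inner_cscale_right cnj_hs_inner mult.commute)

lemma frame_op_selfadjoint: "X \<bullet> F Y = F X \<bullet> Y"
proof -
  have "hs_inner X (F Y) = cnj (hs_inner Y (F X))"
    by (simp add: hs_inner_frame_op mult.commute)
  then have "Re (hs_inner X (F Y)) = Re (hs_inner Y (F X))" by simp
  then show ?thesis by (simp add: Re_hs_inner inner_commute)
qed

section \<open>Invertibility of the frame operator and the dual frame\<close>

lemma frame_op_pos:
  assumes "X \<noteq> 0" shows "0 < X \<bullet> F X"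
proof -
  have norm_sq: "cnj z * z = of_real ((cmod z)\<^sup>2)" for z
    by (metis complex_norm_square mult.commute)
  have eq: "X \<bullet> F X = (\<Sum>a\<in>UNIV. (cmod (hs_inner (A a) X))\<^sup>2 / t a)"
    unfolding Re_hs_inner[symmetric] hs_inner_frame_op Re_sum
    by (simp add: norm_sq Re_divide_of_real del: of_real_power)
  \<comment> \<open>An \<open>X\<close> orthogonal to all effects is orthogonal to their span, hence
    to itself.\<close>
  have "\<exists>a. hs_inner (A a) X \<noteq> 0"
  proof (rule ccontr)
    assume "\<not> ?thesis"
    then have zero: "hs_inner X (A a) = 0" for a by (metis cnj_hs_inner complex_cnj_zero)
    have "hs_inner X Y = 0" if "Y \<in> cop.span (range A)" for Y
      using that
    proof (induction rule: cop.span_induct_alt)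
      case base
      show ?case by (simp add: hs_inner_sum)
    next
      case (step c Y Z)
      then show ?case using zero by (auto simp: hs_inner_add_right hs_inner_cscale_right)
    qed
    then have "hs_inner X X = 0" using complete by (simp add: informationally_complete_def)
    then have "X \<bullet> X = 0" by (metis Re_hs_inner zero_complex.sel(1))
    then show False using assms by simp
  qed
  then obtain a where "hs_inner (A a) X \<noteq> 0" by blast
  then show ?thesis unfolding eq
    by (intro sum_pos2[where i = a]) (use t_pos in \<open>auto intro!: divide_pos_pos divide_nonneg_pos\<close>)
qed

text \<open>Positive definiteness leaves no kernel and finite dimension does the rest;
  \<open>inv\<close> in \<open>optimal_dual\<close> is thus a genuine inverse.\<close>

lemma bij_frame_op: "bij F"
proof -
  have inj: "inj F"
    unfolding linear_injective_0[OF linear_frame_op] using frame_op_pos by fastforce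
  then show ?thesis
    using linear_injective_imp_surjective[OF linear_frame_op] by (simp add: bij_def)
qed

lemma frame_op_dual: "F (D a) = (1 / t a) *\<^sub>R A a"
proof -
  have "F (D a) = cscale (of_real (1 / t a)) (A a)"
    unfolding optimal_dual_def hs_inner_A_mat_1
    by (subst surj_f_inv_f[OF bij_is_surj[OF bij_frame_op]]) simp
  then show ?thesis by (simp only: cscale_of_real)
qed

text \<open>Checked after applying the injective \<open>F\<close>, which turns the sum into the
  definition of \<open>F X\<close>.\<close>

lemma dual_frame: "(\<Sum>a\<in>UNIV. cscale (hs_inner (A a) X) (D a)) = X"
proof -
  have "F (\<Sum>a\<in>UNIV. cscale (hs_inner (A a) X) (D a))
      = (\<Sum>a\<in>UNIV. cscale (hs_inner (A a) X) (cscale (of_real (1 / t a)) (A a)))"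
    by (simp only: linear_sum[OF linear_frame_op] frame_op_cscale frame_op_dual cscale_of_real)
  also have "\<dots> = F X" by (simp add: frame_op_eq)
  finally show ?thesis by (simp add: bij_is_inj[OF bij_frame_op] inj_eq)
qed

text \<open>Every coefficient is \<open>t a / t a\<close>. By self-adjointness \<open>F\<close> then
  also preserves the traceless operators.\<close>

lemma frame_op_mat_1: "F (mat 1) = mat 1"
  using t_pos by (simp add: frame_op_eq hs_inner_A_mat_1 sum_A less_imp_neq[symmetric])

lemma mat_1_inner_dual: "mat 1 \<bullet> D a = 1"
proof -
  have "mat 1 \<bullet> D a = mat 1 \<bullet> F (D a)" by (simp add: frame_op_selfadjoint frame_op_mat_1)
  also have "\<dots> = 1" using t_pos[of a] by (simp add: frame_op_dual mat_1_inner)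
  finally show ?thesis .
qed

text \<open>The trace of the identity on operators, computed in the frame.\<close>

lemma sum_A_inner_dual: "(\<Sum>a\<in>UNIV. A a \<bullet> D a) = d\<^sup>2"
proof -
  have "(\<Sum>a\<in>UNIV. cnj (A a $ i $ j) * D a $ i $ j) = 1" for i j
  proof -
    \<comment> \<open>The matrix unit at \<open>(i, j)\<close>: reading its reconstruction at that
      entry gives one diagonal entry of the identity on operators.\<close>
    define E :: "'n op" where "E = (\<chi> k l. if k = i \<and> l = j then 1 else 0)"
    have "(\<Sum>l\<in>UNIV. cnj (X $ k $ l) * E $ k $ l) = (if k = i then cnj (X $ i $ j) else 0)" for X k
      by (simp add: E_def if_distrib[of "(*) _"] cong: if_cong)
    then have E: "hs_inner X E = cnj (X $ i $ j)" for X by (simp add: hs_inner_sum)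
    have "(\<Sum>a\<in>UNIV. cscale (hs_inner (A a) E) (D a)) $ i $ j = E $ i $ j"
      by (simp only: dual_frame)
    then show ?thesis by (simp add: E cscale_def) (simp add: E_def)
  qed
  then have "(\<Sum>i\<in>UNIV. \<Sum>j\<in>UNIV. \<Sum>a\<in>UNIV. cnj (A a $ i $ j) * D a $ i $ j) = of_real (d\<^sup>2)"
    by (simp add: power2_eq_square dim)
  moreover have "(\<Sum>a\<in>UNIV. hs_inner (A a) (D a))
      = (\<Sum>i\<in>UNIV. \<Sum>j\<in>UNIV. \<Sum>a\<in>UNIV. cnj (A a $ i $ j) * D a $ i $ j)"
    unfolding hs_inner_sum by (subst sum.swap, intro sum.cong refl, rule sum.swap)
  ultimately have "Re (\<Sum>a\<in>UNIV. hs_inner (A a) (D a)) = d\<^sup>2" by simp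
  then show ?thesis by (simp add: Re_hs_inner)
qed

text \<open>In the extremal case \<open>F\<close> is multiplication by \<open>1 / (d + 1)\<close> on traceless operators, that is
  \<open>D\<^sub>a = (d + 1) A\<^sub>a / t\<^sub>a - I\<close>; the square expanded here measures the deviation from it.\<close>

lemma dual_norm_sum_lower: "d * (d\<^sup>2 + d - 1) \<le> (\<Sum>a\<in>UNIV. t a * (norm (D a))\<^sup>2)"
proof -
  have sq: "t a * (norm (D a + mat 1 - ((d + 1) / t a) *\<^sub>R A a))\<^sup>2
      \<le> t a * (norm (D a))\<^sup>2 + t a * (d + 2) + (d + 1)\<^sup>2 * t a
        - 2 * (d + 1) * (A a \<bullet> D a) - 2 * (d + 1) * t a" for a
  proof -
    have t: "t a > 0" by (rule t_pos)
    \<comment> \<open>The one estimate inside the expansion; it is sharp for rank-one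
      effects.\<close>
    have "(norm (A a))\<^sup>2 \<le> (t a)\<^sup>2"
      using psd_norm_le_trace[OF psd_A[of a]] by (simp add: power_mono)
    then have "(norm (A a))\<^sup>2 / t a \<le> t a"
      using t by (simp add: pos_divide_le_eq power2_eq_square)
    then have "(d + 1)\<^sup>2 * ((norm (A a))\<^sup>2 / t a) \<le> (d + 1)\<^sup>2 * t a"
      by (intro mult_left_mono) simp_all
    moreover have "t a * (norm (D a + mat 1 - ((d + 1) / t a) *\<^sub>R A a))\<^sup>2
      = t a * (norm (D a))\<^sup>2 + t a * (d + 2) + (d + 1)\<^sup>2 * ((norm (A a))\<^sup>2 / t a)
        - 2 * (d + 1) * (A a \<bullet> D a) - 2 * (d + 1) * t a"
    proof -
      have "(norm (D a + mat 1 - k *\<^sub>R A a))\<^sup>2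
         = (norm (D a))\<^sup>2 + 2 * (mat 1 \<bullet> D a) + mat 1 \<bullet> (mat 1 :: 'n op)
           + k\<^sup>2 * (norm (A a))\<^sup>2 - 2 * k * (A a \<bullet> D a) - 2 * k * (mat 1 \<bullet> A a)" for k
        unfolding power2_norm_eq_inner
        by (simp add: inner_add_left inner_add_right inner_diff_left inner_diff_right
            inner_commute power2_eq_square algebra_simps)
      then have "(norm (D a + mat 1 - k *\<^sub>R A a))\<^sup>2 = (norm (D a))\<^sup>2 + (d + 2)
          + k\<^sup>2 * (norm (A a))\<^sup>2 - 2 * k * (A a \<bullet> D a) - 2 * k * t a" for k
        unfolding mat_1_inner_dual mat_1_inner_mat_1 unfolding mat_1_inner by simp
      from this[of "(d + 1) / t a"] show ?thesis using t by (simp only:) (simp add: power2_eq_square field_simps)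
    qed
    ultimately show ?thesis by linarith
  qed
  have "0 \<le> (\<Sum>a\<in>UNIV. t a * (norm (D a + mat 1 - ((d + 1) / t a) *\<^sub>R A a))\<^sup>2)"
    by (intro sum_nonneg mult_nonneg_nonneg less_imp_le[OF t_pos]) simp
  also have "\<dots> \<le> (\<Sum>a\<in>UNIV. t a * (norm (D a))\<^sup>2 + t a * (d + 2) + (d + 1)\<^sup>2 * t a
        - 2 * (d + 1) * (A a \<bullet> D a) - 2 * (d + 1) * t a)"
    by (intro sum_mono sq)
  \<comment> \<open>The terms after the first add up to
    \<open>- d * (d\<^sup>2 + d - 1)\<close>.\<close>
  also have "\<dots> = (\<Sum>a\<in>UNIV. t a * (norm (D a))\<^sup>2) + d * (d + 2) + (d + 1)\<^sup>2 * d
        - 2 * (d + 1) * d\<^sup>2 - 2 * (d + 1) * d"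
    by (simp only: sum.distrib sum_subtractf sum_distrib_left[symmetric]
        sum_distrib_right[symmetric] sum_t sum_A_inner_dual)
  finally show ?thesis by (simp add: power2_eq_square algebra_simps)
qed

section \<open>The smallest eigenvalue and the upper bound\<close>

lemma stability_is_eigenvalue: "\<exists>X. X \<noteq> 0 \<and> F X = s *\<^sub>R X"
  and stability_le_Rayleigh: "s * (norm Y)\<^sup>2 \<le> Y \<bullet> F Y"
proof -
  let ?E = "{l. \<exists>X. X \<noteq> 0 \<and> F X = l *\<^sub>R X}"
  \<comment> \<open>Complex and real scaling agree on real scalars, so the minimum ranges over the
    eigenvalues of \<open>F\<close> as a real operator.\<close>
  have s: "s = Min ?E"
    by (simp add: completeness_stability_def op_eigenvalues_def cscale_of_real)
  have fin: "finite ?E" by (rule selfadjoint_finite_eigenvalues) (rule frame_op_selfadjoint)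
  obtain l X where l: "X \<noteq> 0" "F X = l *\<^sub>R X" and min: "\<And>Y. l * (norm Y)\<^sup>2 \<le> Y \<bullet> F Y"
    using selfadjoint_min_eigenvector[OF linear_frame_op frame_op_selfadjoint] by blast
  \<comment> \<open>The Rayleigh minimizer makes the set nonempty, so its minimum is attained and is
    at most \<open>l\<close>.\<close>
  have lE: "l \<in> ?E" using l by blast
  then have "Min ?E \<in> ?E" using Min_in[OF fin] by blast
  then show "\<exists>X. X \<noteq> 0 \<and> F X = s *\<^sub>R X" by (simp add: s)
  have "s \<le> l" unfolding s using fin lE by (rule Min_le)
  then have "s * (norm Y)\<^sup>2 \<le> l * (norm Y)\<^sup>2" by (simp add: mult_right_mono)
  then show "s * (norm Y)\<^sup>2 \<le> Y \<bullet> F Y" using min[of Y] by linarith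
qed

lemma stability_pos: "0 < s"
proof -
  obtain X where X: "X \<noteq> 0" "F X = s *\<^sub>R X" using stability_is_eigenvalue by blast
  then have "0 < s * (X \<bullet> X)" using frame_op_pos[of X] by simp
  moreover have "0 < X \<bullet> X" using X by simp
  ultimately show ?thesis by (rule zero_less_mult_pos2)
qed

text \<open>Splitting off the component along the identity, where \<open>F\<close> has eigenvalue 1,
  improves \<open>d\<^sup>2\<close> to \<open>d\<^sup>2 - 1\<close>; that component contributes the
  separate \<open>+ 1\<close>.\<close>

lemma dual_norm_sum_upper: "(\<Sum>a\<in>UNIV. t a * (norm (D a))\<^sup>2) \<le> (d\<^sup>2 - 1) / s + 1"
proof -
  have d: "d > 0" by (simp add: dim)
  define B where "B a = D a - (1 / d) *\<^sub>R mat 1" for a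
  have FB: "F (B a) = (1 / t a) *\<^sub>R A a - (1 / d) *\<^sub>R mat 1" for a
    by (simp add: B_def linear_diff[OF linear_frame_op] linear_cmul[OF linear_frame_op]
        frame_op_dual frame_op_mat_1)
  have BF: "t a * (B a \<bullet> F (B a)) = A a \<bullet> D a - t a / d" for a
  proof -
    have "B a \<bullet> F (B a) = (1 / t a) * (A a \<bullet> D a) - (1 / d) * (mat 1 \<bullet> D a)
        - (1 / (d * t a)) * (mat 1 \<bullet> A a) + (1 / d)\<^sup>2 * (mat 1 \<bullet> (mat 1 :: 'n op))"
      unfolding FB by (simp add: B_def inner_diff_left inner_diff_right inner_commute power2_eq_square)
    also have "\<dots> = (1 / t a) * (A a \<bullet> D a) - 1 / d"
      unfolding mat_1_inner_dual mat_1_inner_mat_1 unfolding mat_1_inner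
      using t_pos[of a] d by (simp add: power2_eq_square)
    finally show ?thesis using t_pos[of a] by (simp add: field_simps)
  qed
  \<comment> \<open>Pythagoras: the removed component is orthogonal to \<open>B a\<close> and has
    squared norm \<open>1 / d\<close>.\<close>
  have BB: "t a * (norm (B a))\<^sup>2 = t a * (norm (D a))\<^sup>2 - t a / d" for a
  proof -
    have "(norm (B a))\<^sup>2 = (norm (D a))\<^sup>2 - 2 * (1 / d) * (mat 1 \<bullet> D a)
        + (1 / d)\<^sup>2 * (mat 1 \<bullet> (mat 1 :: 'n op))"
      unfolding power2_norm_eq_inner
      by (simp add: B_def inner_diff_left inner_diff_right inner_commute power2_eq_square)
    also have "\<dots> = (norm (D a))\<^sup>2 - 1 / d"
      using d by (simp add: mat_1_inner_dual mat_1_inner_mat_1 power2_eq_square)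
    finally show ?thesis
      by (simp only: right_diff_distrib times_divide_eq_right mult_1_right)
  qed
  have "s * ((\<Sum>a\<in>UNIV. t a * (norm (D a))\<^sup>2) - 1) = (\<Sum>a\<in>UNIV. t a * (s * (norm (B a))\<^sup>2))"
  proof -
    have "(\<Sum>a\<in>UNIV. t a * (norm (B a))\<^sup>2) = (\<Sum>a\<in>UNIV. t a * (norm (D a))\<^sup>2) - 1"
      using d by (simp add: BB sum_subtractf sum_divide_distrib[symmetric] sum_t)
    then have "s * ((\<Sum>a\<in>UNIV. t a * (norm (D a))\<^sup>2) - 1) = s * (\<Sum>a\<in>UNIV. t a * (norm (B a))\<^sup>2)"
      by simp
    then show ?thesis by (simp add: sum_distrib_left mult_ac)
  qed
  also have "\<dots> \<le> (\<Sum>a\<in>UNIV. t a * (B a \<bullet> F (B a)))"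
    by (intro sum_mono mult_left_mono stability_le_Rayleigh less_imp_le[OF t_pos])
  also have "\<dots> = d\<^sup>2 - 1"
    using d by (simp add: BF sum_subtractf sum_A_inner_dual sum_divide_distrib[symmetric] sum_t)
  finally show ?thesis using stability_pos by (simp add: field_simps)
qed

end

subsection \<open>Mean squared error under multinomial sampling\<close>

text \<open>Cross terms of independent centred summands vanish. The offset \<open>c\<close> is
  arbitrary so that the induction can absorb the first draw into it.\<close>

lemma expectation_norm_sum_list_sq:
  fixes Y :: "'a::finite \<Rightarrow> 'v::real_inner"
  assumes mean: "(\<Sum>x\<in>UNIV. pmf p x *\<^sub>R Y x) = 0"
  shows "measure_pmf.expectation (replicate_pmf n p) (\<lambda>xs. (norm (c + sum_list (map Y xs)))\<^sup>2)
       = (norm c)\<^sup>2 + real n * (\<Sum>x\<in>UNIV. pmf p x * (norm (Y x))\<^sup>2)"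
proof (induction n arbitrary: c)
  case (Suc n)
  let ?V = "\<Sum>x\<in>UNIV. pmf p x * (norm (Y x))\<^sup>2"
  have p1: "(\<Sum>x\<in>UNIV. pmf p x) = 1" by (rule sum_pmf_eq_1) auto
  have fin: "finite (set_pmf (replicate_pmf n p))"
    unfolding set_replicate_pmf
    by (rule finite_subset[OF _ finite_lists_length_eq[of UNIV n]]) auto
  have unfold: "replicate_pmf (Suc n) p = p \<bind> (\<lambda>x. map_pmf ((#) x) (replicate_pmf n p))"
    by (simp add: map_pmf_def)
  have "measure_pmf.expectation (replicate_pmf (Suc n) p) (\<lambda>xs. (norm (c + sum_list (map Y xs)))\<^sup>2)
     = (\<Sum>x\<in>UNIV. pmf p x * measure_pmf.expectation (replicate_pmf n p)
         (\<lambda>xs. (norm ((c + Y x) + sum_list (map Y xs)))\<^sup>2))"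
    unfolding unfold using fin by (subst pmf_expectation_bind[where A = UNIV]) (auto simp: add.assoc)
  also have "\<dots> = (\<Sum>x\<in>UNIV. pmf p x * ((norm (c + Y x))\<^sup>2 + real n * ?V))"
    by (simp only: Suc.IH)
  also have "\<dots> = (\<Sum>x\<in>UNIV. pmf p x * ((norm c)\<^sup>2 + real n * ?V)
      + 2 * (c \<bullet> (pmf p x *\<^sub>R Y x)) + pmf p x * (norm (Y x))\<^sup>2)"
    by (intro sum.cong refl)
      (simp add: power2_norm_eq_inner inner_add_left inner_add_right inner_commute algebra_simps)
  also have "\<dots> = (\<Sum>x\<in>UNIV. pmf p x) * ((norm c)\<^sup>2 + real n * ?V)
      + 2 * (c \<bullet> (\<Sum>x\<in>UNIV. pmf p x *\<^sub>R Y x)) + ?V"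
    by (simp only: sum.distrib sum_distrib_left[symmetric] sum_distrib_right[symmetric] inner_sum_right)
  also have "\<dots> = (norm c)\<^sup>2 + real (Suc n) * ?V"
    by (simp add: p1 mean algebra_simps)
  finally show ?case .
qed simp

text \<open>Turns outcome counts back into individual draws, for which independence is
  available.\<close>

lemma sum_count_list_scaleR:
  fixes Y :: "'a::finite \<Rightarrow> 'v::real_vector"
  shows "(\<Sum>a\<in>UNIV. real (count_list xs a) *\<^sub>R Y a) = sum_list (map Y xs)"
proof (induction xs)
  case (Cons x xs)
  have "(\<Sum>a\<in>UNIV. real (count_list (x # xs) a) *\<^sub>R Y a)
      = (\<Sum>a\<in>UNIV. (if a = x then Y a else 0) + real (count_list xs a) *\<^sub>R Y a)"
    by (intro sum.cong refl) (auto simp: scaleR_left_distrib)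
  then show ?case using Cons by (simp add: sum.distrib)
qed simp

lemma expectation_multinomial_norm_sq:
  fixes Y :: "'a::finite \<Rightarrow> 'v::real_inner"
  assumes mean: "(\<Sum>x\<in>UNIV. pmf p x *\<^sub>R Y x) = r" and n: "n \<ge> 1"
  shows "measure_pmf.expectation (multinomial_pmf n p)
           (\<lambda>N. (norm ((\<Sum>a\<in>UNIV. (real (N a) / real n) *\<^sub>R Y a) - r))\<^sup>2)
       = 1 / real n * ((\<Sum>x\<in>UNIV. pmf p x * (norm (Y x))\<^sup>2) - (norm r)\<^sup>2)"
proof -
  have p1: "(\<Sum>x\<in>UNIV. pmf p x) = 1" by (rule sum_pmf_eq_1) auto
  have centred: "(\<Sum>x\<in>UNIV. pmf p x *\<^sub>R (Y x - r)) = 0"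
    by (simp add: scaleR_right_diff_distrib sum_subtractf mean scaleR_left.sum[symmetric] p1)
  have var: "(\<Sum>x\<in>UNIV. pmf p x * (norm (Y x - r))\<^sup>2)
      = (\<Sum>x\<in>UNIV. pmf p x * (norm (Y x))\<^sup>2) - (norm r)\<^sup>2"
  proof -
    have "(\<Sum>x\<in>UNIV. pmf p x * (norm (Y x - r))\<^sup>2)
        = (\<Sum>x\<in>UNIV. pmf p x * (norm (Y x))\<^sup>2 - 2 * (r \<bullet> (pmf p x *\<^sub>R Y x)) + pmf p x * (norm r)\<^sup>2)"
      by (intro sum.cong refl)
        (simp add: power2_norm_eq_inner inner_diff_left inner_diff_right inner_commute algebra_simps)
    also have "\<dots> = (\<Sum>x\<in>UNIV. pmf p x * (norm (Y x))\<^sup>2) - 2 * (r \<bullet> r) + (norm r)\<^sup>2"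
      by (simp only: sum.distrib sum_subtractf sum_distrib_left[symmetric]
          sum_distrib_right[symmetric] inner_sum_right[symmetric] mean p1 mult_1_left)
    finally show ?thesis by (simp add: power2_norm_eq_inner)
  qed
  \<comment> \<open>Lists in the support have length \<open>n\<close>, so the error is
    \<open>1 / n\<close> times a sum of centred draws; the summand \<open>0\<close> is the offset in
    \<open>expectation_norm_sum_list_sq\<close>.\<close>
  have "(norm ((\<Sum>a\<in>UNIV. (real (count_list xs a) / real n) *\<^sub>R Y a) - r))\<^sup>2
      = (1 / real n)\<^sup>2 * (norm (0 + sum_list (map (\<lambda>x. Y x - r) xs)))\<^sup>2"
    if "xs \<in> set_pmf (replicate_pmf n p)" for xs
  proof -
    have len: "length xs = n" using that by (simp add: set_replicate_pmf)
    have "sum_list (map (\<lambda>x. Y x - r) xs) = sum_list (map Y xs) - real (length xs) *\<^sub>R r"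
      by (induction xs) (simp_all add: scaleR_left_distrib)
    then have "(1 / real n) *\<^sub>R (0 + sum_list (map (\<lambda>x. Y x - r) xs))
        = (1 / real n) *\<^sub>R (\<Sum>a\<in>UNIV. real (count_list xs a) *\<^sub>R Y a) - r"
      using n by (simp add: len sum_count_list_scaleR scaleR_right_diff_distrib)
    also have "(1 / real n) *\<^sub>R (\<Sum>a\<in>UNIV. real (count_list xs a) *\<^sub>R Y a)
        = (\<Sum>a\<in>UNIV. (real (count_list xs a) / real n) *\<^sub>R Y a)"
      by (simp add: scaleR_right.sum)
    finally show ?thesis
      by (simp only: power2_abs[of "1 / real n", symmetric] power_mult_distrib[symmetric]
          norm_scaleR[symmetric])
  qed
  then have "measure_pmf.expectation (multinomial_pmf n p)
           (\<lambda>N. (norm ((\<Sum>a\<in>UNIV. (real (N a) / real n) *\<^sub>R Y a) - r))\<^sup>2)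
      = measure_pmf.expectation (replicate_pmf n p)
           (\<lambda>xs. (1 / real n)\<^sup>2 * (norm (0 + sum_list (map (\<lambda>x. Y x - r) xs)))\<^sup>2)"
    unfolding multinomial_pmf_def integral_map_pmf
    by (intro integral_cong_AE) (simp_all add: AE_measure_pmf_iff)
  also have "\<dots> = (1 / real n)\<^sup>2 * (real n * (\<Sum>x\<in>UNIV. pmf p x * (norm (Y x - r))\<^sup>2))"
    by (simp only: integral_mult_right_zero expectation_norm_sum_list_sq[OF centred]) simp
  also have "\<dots> = 1 / real n * (\<Sum>x\<in>UNIV. pmf p x * (norm (Y x - r))\<^sup>2)"
    using n by (simp add: power2_eq_square[of "1 / real n"])
  finally show ?thesis by (simp only: var)
qed

lemma trace_mult_hermitian: "dagger X = X \<Longrightarrow> Re (trace (X ** Y)) = X \<bullet> Y"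
  by (metis Re_hs_inner hs_inner_def)

lemma purity_hermitian: "dagger X = X \<Longrightarrow> purity X = (norm X)\<^sup>2"
  by (simp add: purity_def trace_mult_hermitian power2_norm_eq_inner)

context ic_povm
begin

text \<open>\<open>embed_pmf\<close> reproduces weights that are nonnegative and sum to one; here
  this follows from \<open>trace_psd_mult_nonneg\<close> and from \<open>sum_A\<close> with
  \<open>trace \<rho> = 1\<close>.\<close>

lemma pmf_outcome:
  assumes "quantum_state \<rho>" shows "pmf (outcome_pmf A \<rho>) a = \<rho> \<bullet> A a"
proof -
  have psd: "psd \<rho>" and tr: "trace \<rho> = 1" using assms by (simp_all add: quantum_state_def)
  then have herm: "dagger \<rho> = \<rho>" by (simp add: psd_def)
  have nonneg: "0 \<le> \<rho> \<bullet> A a" for a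
    using trace_psd_mult_nonneg[OF psd psd_A] by (simp add: trace_mult_hermitian herm)
  have "(\<Sum>a\<in>UNIV. \<rho> \<bullet> A a) = mat 1 \<bullet> \<rho>"
    by (simp only: inner_sum_right[symmetric] sum_A inner_commute)
  then have "(\<Sum>a\<in>UNIV. \<rho> \<bullet> A a) = 1" by (simp add: mat_1_inner tr)
  then have "(\<integral>\<^sup>+ a. ennreal (\<rho> \<bullet> A a) \<partial>count_space UNIV) = 1"
    by (simp add: nn_integral_count_space_finite sum_ennreal nonneg)
  then show ?thesis
    unfolding outcome_pmf_def trace_mult_hermitian[OF herm] by (intro pmf_embed_pmf nonneg)
qed

text \<open>Cyclicity of the trace makes the frame coefficients of a Hermitian operator real. For a
  state this says that the estimator is unbiased.\<close>

lemma dual_frame_hermitian: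
  assumes herm: "dagger X = X" shows "(\<Sum>a\<in>UNIV. (X \<bullet> A a) *\<^sub>R D a) = X"
proof -
  have "hs_inner (A a) X = of_real (X \<bullet> A a)" for a
  proof -
    have "hs_inner (A a) X = hs_inner X (A a)"
      using psd_A[of a] herm trace_mul_sym[of "A a" X] by (simp add: hs_inner_def psd_def)
    then have "Im (hs_inner (A a) X) = 0"
      using cnj_hs_inner[of "A a" X] by (simp add: complex_eq_iff)
    then show ?thesis by (simp add: complex_eq_iff Re_hs_inner inner_commute)
  qed
  then show ?thesis using dual_frame[of X] by (simp add: cscale_of_real)
qed

lemma mse_optimal_dual:
  assumes "quantum_state \<rho>" "n \<ge> 1"
  shows "mse A D n \<rho> = 1 / real n * ((\<Sum>a\<in>UNIV. (\<rho> \<bullet> A a) * (norm (D a))\<^sup>2) - purity \<rho>)"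
proof -
  have herm: "dagger \<rho> = \<rho>" using assms(1) by (simp add: quantum_state_def psd_def)
  show ?thesis
    unfolding mse_def linear_estimator_def hs_norm_eq_norm purity_hermitian[OF herm]
    using assms by (subst expectation_multinomial_norm_sq)
      (simp_all add: pmf_outcome dual_frame_hermitian herm)
qed

end

subsection \<open>Averaging over the unitary group\<close>

lemma dagger_unitary: "U \<in> unitary_group \<Longrightarrow> dagger U ** U = mat 1"
  by (simp add: unitary_group_def)

lemma unitary_mult: "V \<in> unitary_group \<Longrightarrow> U \<in> unitary_group \<Longrightarrow> V ** U \<in> unitary_group"
  unfolding unitary_group_def dagger_mult mem_Collect_eq
  by (metis matrix_mul_assoc matrix_mul_lid)

lemma trace_unitary_conj:
  assumes "U \<in> unitary_group" shows "trace (U ** X ** dagger U) = trace X"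
  by (metis assms dagger_unitary matrix_mul_assoc matrix_mul_lid trace_mul_sym)

lemma quantum_state_unitary_conj:
  assumes \<rho>: "quantum_state \<rho>" and U: "U \<in> unitary_group"
  shows "quantum_state (U ** \<rho> ** dagger U)" and "purity (U ** \<rho> ** dagger U) = purity \<rho>"
proof -
  have "dagger (U ** \<rho> ** dagger U) = U ** \<rho> ** dagger U"
    using \<rho> by (simp add: dagger_mult matrix_mul_assoc quantum_state_def psd_def)
  moreover have "0 \<le> Re (cdot v ((U ** \<rho> ** dagger U) *v v))" for v
  proof -
    have "cdot v ((U ** \<rho> ** dagger U) *v v) = cdot (dagger U *v v) (\<rho> *v (dagger U *v v))"
      by (simp add: matrix_vector_mul_assoc[symmetric] cdot_adjoint[of v U])
    then show ?thesis using \<rho> by (simp add: quantum_state_def psd_iff_cdot)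
  qed
  ultimately show "quantum_state (U ** \<rho> ** dagger U)"
    using \<rho> U by (simp add: quantum_state_def psd_iff_cdot trace_unitary_conj)
  have "(U ** \<rho> ** dagger U) ** (U ** \<rho> ** dagger U) = U ** \<rho> ** (dagger U ** U) ** \<rho> ** dagger U"
    by (simp add: matrix_mul_assoc)
  also have "\<dots> = U ** (\<rho> ** \<rho>) ** dagger U"
    by (simp add: dagger_unitary[OF U] matrix_mul_assoc)
  finally show "purity (U ** \<rho> ** dagger U) = purity \<rho>"
    by (simp add: purity_def trace_unitary_conj[OF U])
qed

text \<open>One family covering the diagonal sign matrices (\<open>\<pi> = id\<close>) and the
  permutation matrices (\<open>c\<close> constantly 1).\<close>

definition monomial_matrix :: "('n \<Rightarrow> complex) \<Rightarrow> ('n \<Rightarrow> 'n) \<Rightarrow> 'n::finite op" where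
  "monomial_matrix c \<pi> = (\<chi> i j. if j = \<pi> i then c i else 0)"

lemma monomial_matrix_mult: "(monomial_matrix c \<pi> ** X) $ i $ j = c i * X $ \<pi> i $ j"
  by (simp add: monomial_matrix_def matrix_matrix_mult_def if_distrib[of "\<lambda>x. x * _"] cong: if_cong)

lemma mult_dagger_monomial_matrix:
  "(X ** dagger (monomial_matrix c \<pi>)) $ i $ j = X $ i $ \<pi> j * cnj (c j)"
  by (simp add: monomial_matrix_def matrix_matrix_mult_def dagger_def if_distrib[of "(*) _"]
      if_distrib[of cnj] cong: if_cong)

lemma monomial_matrix_unitary:
  assumes "\<And>i. cmod (c i) = 1" "inj \<pi>"
  shows "monomial_matrix c \<pi> \<in> unitary_group"
proof -
  have "c i * cnj (c i) = 1" for i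
    using assms(1)[of i] by (metis complex_norm_square of_real_1 one_power2)
  then have "monomial_matrix c \<pi> ** dagger (monomial_matrix c \<pi>) = mat 1"
    using assms(2) unfolding vec_eq_iff mult_dagger_monomial_matrix
    by (auto simp: monomial_matrix_def mat_def inj_eq)
  then show ?thesis by (simp add: unitary_group_def matrix_left_right_inverse)
qed

text \<open>Diagonal sign matrices annihilate the off-diagonal entries and transpositions equate
  the diagonal ones.\<close>

lemma unitary_invariant_imp_scalar:
  fixes M :: "'n::finite op"
  assumes inv: "\<And>V. V \<in> unitary_group \<Longrightarrow> V ** M ** dagger V = M"
  shows "M = cscale (trace M / of_nat CARD('n)) (mat 1)"
proof -
  have entry: "c i * M $ \<pi> i $ \<pi> j * cnj (c j) = M $ i $ j"
    if "\<And>i. cmod (c i) = 1" "inj \<pi>" for c \<pi> i j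
  proof -
    have "(monomial_matrix c \<pi> ** M ** dagger (monomial_matrix c \<pi>)) $ i $ j = M $ i $ j"
      using inv[OF monomial_matrix_unitary[OF that]] by simp
    then show ?thesis by (simp add: mult_dagger_monomial_matrix monomial_matrix_mult)
  qed
  have off: "M $ i $ j = 0" if "i \<noteq> j" for i j
    using entry[of "\<lambda>k. if k = i then -1 else 1" id i j] that by (simp add: equal_neg_zero)
  have diag: "M $ i $ i = M $ j $ j" for i j
  proof -
    define \<pi> where "\<pi> k = (if k = i then j else if k = j then i else k)" for k
    have "inj \<pi>" by (auto simp: inj_def \<pi>_def split: if_splits)
    then show ?thesis using entry[of "\<lambda>_. 1" \<pi> i i] by (simp add: \<pi>_def)
  qed
  have tr: "trace M = of_nat CARD('n) * M $ i $ i" for i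
  proof -
    have "trace M = (\<Sum>k\<in>(UNIV :: 'n set). M $ i $ i)" unfolding trace_def by (intro sum.cong refl diag)
    then show ?thesis by simp
  qed
  have "M $ i $ i = trace M / of_nat CARD('n)" for i
    by (subst tr[of i]) simp
  then show ?thesis
    unfolding vec_eq_iff using off by (auto simp: cscale_def mat_def)
qed

lemma continuous_on_matrix_mult [continuous_intros]:
  fixes f g :: "'b::topological_space \<Rightarrow> complex ^ 'n ^ 'n"
  assumes "continuous_on S f" "continuous_on S g"
  shows "continuous_on S (\<lambda>x. f x ** g x)"
  unfolding matrix_matrix_mult_def
  by (intro continuous_intros assms)

lemma continuous_on_dagger [continuous_intros]:
  assumes "continuous_on S f"
  shows "continuous_on S (\<lambda>x. dagger (f x))"
  unfolding dagger_def by (intro continuous_intros assms)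

lemma matrix_add_rdistrib: "((A :: complex ^ 'n ^ 'm) + B) ** C = A ** C + B ** C"
  by (simp add: matrix_matrix_mult_def vec_eq_iff sum.distrib algebra_simps)

text \<open>Left invariance makes the average commute with all unitaries, so it is scalar, and its
  trace is that of \<open>\<rho>\<close>.\<close>

lemma haar_average_conj:
  fixes \<rho> :: "'n::finite op"
  assumes haar: "haar_unitary \<mu>" and \<rho>: "quantum_state \<rho>"
  shows "integrable \<mu> (\<lambda>U. U ** \<rho> ** dagger U)"
    and "(LINT U|\<mu>. U ** \<rho> ** dagger U) = (1 / real CARD('n)) *\<^sub>R mat 1"
proof -
  let ?f = "\<lambda>U. U ** \<rho> ** dagger U"
  interpret prob_space \<mu> using haar by (simp add: haar_unitary_def)
  have sets: "sets \<mu> = sets (restrict_space borel unitary_group)"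
    and inv: "\<And>V. V \<in> unitary_group \<Longrightarrow> distr \<mu> \<mu> (\<lambda>U. V ** U) = \<mu>"
    using haar by (auto simp: haar_unitary_def)
  have space: "space \<mu> = unitary_group"
    using sets_eq_imp_space_eq[OF sets] by (simp add: space_restrict_space)
  have meas: "g \<in> borel_measurable \<mu>" if "continuous_on UNIV g" for g :: "'n op \<Rightarrow> 'n op"
    unfolding measurable_cong_sets[OF sets refl]
    by (intro measurable_restrict_space1 borel_measurable_continuous_onI that)
  have meas_f: "?f \<in> borel_measurable \<mu>"
    by (intro meas continuous_intros)
  have mult_meas: "(\<lambda>U. V ** U) \<in> measurable \<mu> \<mu>" if "V \<in> unitary_group" for V
  proof -
    \<comment> \<open>Closure of the group under products lets the codomain be restricted to the
      group.\<close>
    have "(\<lambda>U. V ** U) \<in> measurable \<mu> (restrict_space borel unitary_group)"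
      using that unitary_mult
      by (intro measurable_restrict_space2 meas continuous_intros) (auto simp: space)
    then show ?thesis by (simp add: measurable_cong_sets[OF refl sets])
  qed
  show int: "integrable \<mu> ?f"
  proof (rule integrable_const_bound[OF _ meas_f])
    \<comment> \<open>Conjugation preserves the purity, so the integrand has constant norm and is
      integrable over a probability space.\<close>
    have "norm (?f U) = sqrt (purity \<rho>)" if U: "U \<in> unitary_group" for U
      using quantum_state_unitary_conj[OF \<rho> U] purity_hermitian[of "?f U"]
      by (metis norm_ge_zero psd_def quantum_state_def real_sqrt_unique)
    then show "AE U in \<mu>. norm (?f U) \<le> sqrt (purity \<rho>)"
      by (intro AE_I2) (simp add: space)
  qed
  define M where "M = (LINT U|\<mu>. ?f U)"
  have "V ** M ** dagger V = M" if V: "V \<in> unitary_group" for V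
  proof -
    \<comment> \<open>Conjugation by \<open>V\<close> passes under the integral and shifts the
      argument from \<open>U\<close> to \<open>V ** U\<close>.\<close>
    have "bounded_linear (\<lambda>X. V ** X ** dagger V)"
      unfolding linear_conv_bounded_linear[symmetric]
      by (intro linearI) (simp_all add: matrix_add_ldistrib matrix_add_rdistrib
          matrix_scalar_ac scalar_matrix_assoc[symmetric])
    then have "V ** M ** dagger V = (LINT U|\<mu>. V ** ?f U ** dagger V)"
      unfolding M_def by (intro integral_bounded_linear[symmetric] int)
    also have "\<dots> = (LINT U|\<mu>. ?f (V ** U))"
      by (simp add: dagger_mult matrix_mul_assoc)
    also have "\<dots> = (LINT U|distr \<mu> \<mu> (\<lambda>U. V ** U). ?f U)"
      by (intro integral_distr[symmetric] mult_meas V meas_f)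
    also have "\<dots> = M" by (simp add: inv[OF V] M_def)
    finally show ?thesis .
  qed
  then have M: "M = cscale (trace M / of_nat CARD('n)) (mat 1)"
    by (rule unitary_invariant_imp_scalar)
  have "bounded_linear (trace :: 'n op \<Rightarrow> complex)"
    unfolding linear_conv_bounded_linear[symmetric]
    by (intro linearI) (simp_all add: trace_def sum.distrib scaleR_right.sum)
  then have "trace M = (LINT U|\<mu>. trace (?f U))"
    unfolding M_def by (intro integral_bounded_linear[symmetric] int)
  also have "\<dots> = (LINT U|\<mu>. 1)"
    using \<rho> by (intro Bochner_Integration.integral_cong)
      (auto simp: space trace_unitary_conj quantum_state_def)
  finally have "trace M = 1" by (simp add: prob_space)
  then have "M = cscale (of_real (1 / real CARD('n))) (mat 1)" using M by simp
  then show "(LINT U|\<mu>. ?f U) = (1 / real CARD('n)) *\<^sub>R mat 1"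
    by (simp only: cscale_of_real M_def)
qed

text \<open>The purity is constant on the unitary orbit and the other term is linear in the state,
  so only the mean of the orbit matters.\<close>

lemma (in ic_povm) averaged_mse_optimal_dual:
  assumes haar: "haar_unitary \<mu>" and \<rho>: "quantum_state \<rho>" and n: "n \<ge> 1"
  shows "averaged_mse \<mu> A D n \<rho>
       = 1 / real n * ((\<Sum>a\<in>UNIV. t a * (norm (D a))\<^sup>2) / d - purity \<rho>)"
proof -
  interpret prob_space \<mu> using haar by (simp add: haar_unitary_def)
  have space: "space \<mu> = unitary_group"
    using haar sets_eq_imp_space_eq[of \<mu> "restrict_space borel unitary_group"]
    by (simp add: haar_unitary_def space_restrict_space)
  let ?f = "\<lambda>U. U ** \<rho> ** dagger U"
  note int = haar_average_conj(1)[OF haar \<rho>]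
  have int': "integrable \<mu> (\<lambda>U. ?f U \<bullet> A a)" for a by (intro integrable_inner_left int)
  have avg: "(LINT U|\<mu>. ?f U \<bullet> A a) = t a / d" for a
    by (simp add: integral_inner_left int haar_average_conj(2)[OF haar \<rho>] mat_1_inner dim)
  have "averaged_mse \<mu> A D n \<rho>
      = (LINT U|\<mu>. 1 / real n * ((\<Sum>a\<in>UNIV. (?f U \<bullet> A a) * (norm (D a))\<^sup>2) - purity \<rho>))"
    unfolding averaged_mse_def
    using n by (intro Bochner_Integration.integral_cong refl)
      (simp add: space mse_optimal_dual quantum_state_unitary_conj[OF \<rho>])
  also have "\<dots> = 1 / real n * ((\<Sum>a\<in>UNIV. t a / d * (norm (D a))\<^sup>2) - purity \<rho>)"
    by (simp add: int' avg prob_space)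
  finally show ?thesis by (simp add: sum_divide_distrib)
qed

theorem mainTheorem4:
  fixes A :: "'a::finite \<Rightarrow> complex ^ 'n::finite ^ 'n"
    and \<rho> :: "complex ^ 'n ^ 'n"
    and \<mu> :: "(complex ^ 'n ^ 'n) measure"
    and n :: nat and d P :: real
  assumes "d = real CARD('n)"
    and "povm A" and "informationally_complete A"
    and "n \<ge> 1"
    and "quantum_state \<rho>" and "purity \<rho> = P"
    and "haar_unitary \<mu>"
  shows "1 / real n * (d\<^sup>2 + d - 1 - P) \<le> averaged_mse \<mu> A (optimal_dual A) n \<rho>
       \<and> averaged_mse \<mu> A (optimal_dual A) n \<rho>
           \<le> 1 / real n * ((d\<^sup>2 - 1) / (d * completeness_stability A) + 1 / d - P)"
proof -
  interpret ic_povm A d using assms(1-3) by unfold_locales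
  let ?T = "\<Sum>a\<in>UNIV. t a * (norm (D a))\<^sup>2"
  have d: "d > 0" using assms(1) by simp
  have "d\<^sup>2 + d - 1 \<le> ?T / d"
    using dual_norm_sum_lower d by (simp add: field_simps)
  \<comment> \<open>Division by \<open>d\<close> turns the \<open>+ 1\<close> of the identity
    component into \<open>1 / d\<close>.\<close>
  moreover have "?T / d \<le> ((d\<^sup>2 - 1) / s + 1) / d"
    using dual_norm_sum_upper d by (intro divide_right_mono) simp_all
  then have "?T / d \<le> (d\<^sup>2 - 1) / (d * s) + 1 / d"
    by (simp add: add_divide_distrib mult.commute)
  ultimately show ?thesis
    using averaged_mse_optimal_dual[OF assms(7,5,4)] assms(6)
    by (simp add: divide_right_mono)
qed

end
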